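(* Let $D$ be a digraph of order $n$ and let $W\subseteq V(D)$. If $\delta^0(W)\geq (3n-3)/4$, then $D$ contains an arbitrary $W$-cycle-factor; that is, for every integer $k\geq 1$ and all integers $n_1,\ldots,n_k\geq 2$ with $|W|=n_1+\cdots+n_k$, there are $k$ pairwise vertex-disjoint directed cycles $C_1,\ldots,C_k$ in $D$ such that $|V(C_i)\cap W|=n_i$ for each $1\leq i\leq k$.
   Context: Digraphs are finite and simple: no loops and no multiple arcs, but both arcs $uv$ and $vu$ may be present. The order of $D$ is $|V(D)|$. Cycles are directed; directed cycles of length $2$ are allowed. For $v\in V(D)$, $d^+_D(v)$ and $d^-_D(v)$ denote the out-degree and in-degree of $v$ in $D$. For $W\subseteq V(D)$, $\delta^+(W)=\min\{d^+_D(v): v\in W\}$, $\delta^-(W)=\min\{d^-_D(v): v\in W\}$, and $\delta^0(W)=\min\{\delta^+(W),\delta^-(W)\}$ (degrees are taken in the whole of $D$). *)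

theory Defs
  imports Complex_Main "HOL-Library.Disjoint_Sets" "Graph_Theory.Arc_Walk"
begin

text \<open>
  Degrees are those of the whole digraph. For \<open>W = {}\<close> these minima are unspecified; this is
  harmless below, since a nonempty sum of numbers \<open>\<ge> 2\<close> never equals \<open>card {}\<close>.
\<close>

definition min_out_degree :: "('a, 'b) pre_digraph \<Rightarrow> 'a set \<Rightarrow> nat" where
  "min_out_degree D W = Min (out_degree D ` W)"

definition min_in_degree :: "('a, 'b) pre_digraph \<Rightarrow> 'a set \<Rightarrow> nat" where
  "min_in_degree D W = Min (in_degree D ` W)"

definition min_semidegree :: "('a, 'b) pre_digraph \<Rightarrow> 'a set \<Rightarrow> nat" where
  "min_semidegree D W = min (min_out_degree D W) (min_in_degree D W)"

text \<open>
  \<open>pre_digraph.cycle\<close> represents a directed cycle by its list of arcs. In a loopfree digraph it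
  admits exactly the directed cycles of length at least \<open>2\<close>
  (\<open>loopfree_digraph.cycle_digraph_conv\<close>).
\<close>

definition cycle_verts :: "('a, 'b) pre_digraph \<Rightarrow> 'b awalk \<Rightarrow> 'a set" where
  "cycle_verts D p = tail D ` set p \<union> head D ` set p"

definition arbitrary_cycle_factor :: "('a, 'b) pre_digraph \<Rightarrow> 'a set \<Rightarrow> bool" where
  "arbitrary_cycle_factor D W \<longleftrightarrow>
     (\<forall>(k::nat) (ns :: nat \<Rightarrow> nat).
        k \<ge> 1 \<and> (\<forall>i\<in>{1..k}. ns i \<ge> 2) \<and> card W = (\<Sum>i=1..k. ns i) \<longrightarrow>
        (\<exists>C :: nat \<Rightarrow> 'b awalk.
           (\<forall>i\<in>{1..k}. pre_digraph.cycle D (C i)) \<and>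
           disjoint_family_on (\<lambda>i. cycle_verts D (C i)) {1..k} \<and>
           (\<forall>i\<in>{1..k}. card (cycle_verts D (C i) \<inter> W) = ns i)))"

end

theory Submission
  imports Defs "HOL-Combinatorics.Permutations"
begin

text \<open>
  Arrange \<open>W\<close> on the positions of disjoint cycles of lengths \<open>n\<^sub>1, \<dots>, n\<^sub>k\<close> so that the number \<open>t\<close> of
  broken steps (consecutive vertices that are not joined by an arc) is minimal. Suppose that the step
  from \<open>x\<close> to \<open>y\<close> is broken, and let \<open>z\<close> precede \<open>x\<close>. Exchanging \<open>x\<close> with any other vertex never
  decreases \<open>t\<close>; summing this over all exchanges shows that the numbers of non-arcs inside \<open>W\<close> that
  leave \<open>z\<close>, enter \<open>y\<close>, enter \<open>x\<close> and leave \<open>x\<close> add up to at least \<open>|W| + t - 1\<close>. (In one tight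
  case with \<open>t = 1\<close> this holds instead for the reversed digraph, where the two terms for arcs
  leaving \<open>x\<close> and entering \<open>y\<close> occur as well.) By the degree condition the four numbers add up to at
  most \<open>n - 1\<close> in the whole digraph, which leaves at least \<open>t\<close> vertices \<open>u\<close> outside \<open>W\<close> with arcs
  from \<open>x\<close> to \<open>u\<close> and from \<open>u\<close> to \<open>y\<close>. So all \<open>t\<close> broken steps can be repaired greedily through
  distinct vertices outside \<open>W\<close>.
\<close>

section \<open>Arrangements on cyclic positions\<close>

text \<open>A fixed-point-free permutation \<open>s\<close> with inverse \<open>r\<close> encodes
  disjoint cycles of length at least 2 without naming them.\<close>

locale arrangement =
  fixes P :: "'p set" and s r :: "'p \<Rightarrow> 'p" and W :: "'a set" and c :: "'a \<Rightarrow> 'a \<Rightarrow> int"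
  assumes finite_P: "finite P"
    and s_in: "\<And>q. q \<in> P \<Longrightarrow> s q \<in> P" and r_in: "\<And>q. q \<in> P \<Longrightarrow> r q \<in> P"
    and r_s: "\<And>q. q \<in> P \<Longrightarrow> r (s q) = q" and s_r: "\<And>q. q \<in> P \<Longrightarrow> s (r q) = q"
    and s_neq: "\<And>q. q \<in> P \<Longrightarrow> s q \<noteq> q"
    and c_self: "\<And>a. c a a = 0" and c_nonneg: "\<And>a b. 0 \<le> c a b" and c_le: "\<And>a b. c a b \<le> 1"
begin

definition cost :: "('p \<Rightarrow> 'a) \<Rightarrow> int" where
  "cost \<phi> = (\<Sum>q\<in>P. c (\<phi> q) (\<phi> (s q)))"

definition optimal :: "('p \<Rightarrow> 'a) \<Rightarrow> bool" where
  "optimal \<phi> \<longleftrightarrow> bij_betw \<phi> P W \<and> (\<forall>\<psi>. bij_betw \<psi> P W \<longrightarrow> cost \<phi> \<le> cost \<psi>)"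

lemma cost_nonneg: "0 \<le> cost \<phi>"
  unfolding cost_def by (rule sum_nonneg) (rule c_nonneg)

lemma optimal_exists:
  assumes "card P = card W" "finite W"
  obtains \<phi> where "optimal \<phi>"
proof -
  obtain \<phi> where \<phi>: "bij_betw \<phi> P W"
    using finite_same_card_bij[OF finite_P assms(2,1)] by blast
  \<comment> \<open>Costs are nonnegative, so \<open>nat\<close> preserves their order and a minimum
    exists.\<close>
  define \<psi> where "\<psi> = arg_min (\<lambda>\<psi>. nat (cost \<psi>)) (\<lambda>\<psi>. bij_betw \<psi> P W)"
  have "bij_betw \<psi> P W" "\<And>\<chi>. bij_betw \<chi> P W \<Longrightarrow> nat (cost \<psi>) \<le> nat (cost \<chi>)"
    unfolding \<psi>_def by (rule arg_min_natI[where P = "\<lambda>\<psi>. bij_betw \<psi> P W", OF \<phi>])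
      (rule arg_min_nat_le[where P = "\<lambda>\<psi>. bij_betw \<psi> P W"])
  then have "optimal \<psi>"
    unfolding optimal_def using cost_nonneg by (metis nat_le_eq_zle le_numeral_extra(3) nat_0_le of_nat_le_iff)
  then show thesis by (rule that)
qed

lemma r_neq: "q \<in> P \<Longrightarrow> r q \<noteq> q"
  by (metis r_in s_neq s_r)

lemma bij_s: "bij_betw s P P"
  by (rule bij_betw_byWitness[where f' = r]) (auto simp: r_s s_r s_in r_in)

lemma bij_r: "bij_betw r P P"
  by (rule bij_betw_byWitness[where f' = s]) (auto simp: r_s s_r s_in r_in)

section \<open>Exchanging two positions\<close>

lemma optimal_transpose:
  assumes "optimal \<phi>" "p \<in> P" "q \<in> P"
  shows "cost \<phi> \<le> cost (\<phi> \<circ> transpose p q)"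
proof -
  have "bij_betw (transpose p q) P P"
    using assms by (intro permutes_imp_bij permutes_swap_id)
  then have "bij_betw (\<phi> \<circ> transpose p q) P W"
    using assms(1) unfolding optimal_def by (blast intro: bij_betw_trans)
  then show ?thesis using assms(1) unfolding optimal_def by blast
qed

text \<open>Steps outside \<open>F\<close> contribute equally to both costs and cancel.\<close>

lemma cost_local:
  assumes "F \<subseteq> P" "\<And>q. q \<in> P - F \<Longrightarrow> \<phi> q = \<psi> q \<and> \<phi> (s q) = \<psi> (s q)" "cost \<phi> \<le> cost \<psi>"
  shows "(\<Sum>q\<in>F. c (\<phi> q) (\<phi> (s q))) \<le> (\<Sum>q\<in>F. c (\<psi> q) (\<psi> (s q)))"
proof -
  have "cost \<chi> = (\<Sum>q\<in>F. c (\<chi> q) (\<chi> (s q))) + (\<Sum>q\<in>P - F. c (\<chi> q) (\<chi> (s q)))" for \<chi>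
    unfolding cost_def using sum.subset_diff[OF assms(1) finite_P] by (simp add: add.commute)
  moreover have "(\<Sum>q\<in>P - F. c (\<phi> q) (\<phi> (s q))) = (\<Sum>q\<in>P - F. c (\<psi> q) (\<psi> (s q)))"
    using assms(2) by (intro sum.cong) auto
  ultimately show ?thesis using assms(3) by simp
qed

text \<open>The exchange alters only the steps starting at \<open>r p\<close>, \<open>p\<close>,
  \<open>r q\<close> and \<open>q\<close>; these are four different steps because \<open>p\<close>
  and \<open>q\<close> are distinct and not adjacent.\<close>

lemma swap_distant:
  assumes "optimal \<phi>" "p \<in> P" "q \<in> P" "q \<noteq> p" "q \<noteq> s p" "q \<noteq> r p"
  shows "c (\<phi> (r p)) (\<phi> p) + c (\<phi> p) (\<phi> (s p)) + c (\<phi> (r q)) (\<phi> q) + c (\<phi> q) (\<phi> (s q))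
    \<le> c (\<phi> (r p)) (\<phi> q) + c (\<phi> q) (\<phi> (s p)) + c (\<phi> (r q)) (\<phi> p) + c (\<phi> p) (\<phi> (s q))"
proof -
  let ?F = "{r p, p, r q, q}" and ?\<psi> = "\<phi> \<circ> transpose p q"
  have ne: "r p \<noteq> p" "r p \<noteq> r q" "r p \<noteq> q" "p \<noteq> r q" "p \<noteq> q" "r q \<noteq> q" "s p \<noteq> p" "s p \<noteq> q"
    "s q \<noteq> p" "s q \<noteq> q"
    using assms r_neq s_neq r_s s_r by metis+
  have "(\<Sum>e\<in>?F. c (\<phi> e) (\<phi> (s e))) \<le> (\<Sum>e\<in>?F. c (?\<psi> e) (?\<psi> (s e)))"
  proof (rule cost_local)
    fix e assume e: "e \<in> P - ?F"
    then have "s e \<noteq> p" "s e \<noteq> q" using r_s by auto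
    then show "\<phi> e = ?\<psi> e \<and> \<phi> (s e) = ?\<psi> (s e)" using e by (simp add: transpose_def)
  qed ((use assms optimal_transpose r_in in blast)+)
  then show ?thesis using ne assms(2,3) by (simp add: s_r transpose_def)
qed

text \<open>Adjacent positions share a step, so only three steps change and the shared one is
  reversed. On a 2-cycle, excluded here, \<open>r p\<close> and \<open>s p\<close> coincide.\<close>

lemma swap_adjacent:
  assumes "optimal \<phi>" "p \<in> P" "s (s p) \<noteq> p"
  shows "c (\<phi> (r p)) (\<phi> p) + c (\<phi> p) (\<phi> (s p)) + c (\<phi> (s p)) (\<phi> (s (s p)))
    \<le> c (\<phi> (r p)) (\<phi> (s p)) + c (\<phi> (s p)) (\<phi> p) + c (\<phi> p) (\<phi> (s (s p)))"
proof -
  let ?F = "{r p, p, s p}" and ?\<psi> = "\<phi> \<circ> transpose p (s p)"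
  have ne: "r p \<noteq> p" "r p \<noteq> s p" "s p \<noteq> p" "s (s p) \<noteq> s p" "s (s p) \<noteq> p"
    using assms r_neq s_neq s_in r_s s_r by metis+
  have "(\<Sum>e\<in>?F. c (\<phi> e) (\<phi> (s e))) \<le> (\<Sum>e\<in>?F. c (?\<psi> e) (?\<psi> (s e)))"
  proof (rule cost_local)
    fix e assume e: "e \<in> P - ?F"
    then have "s e \<noteq> p" "s e \<noteq> s p" using r_s assms(2) by auto metis
    then show "\<phi> e = ?\<psi> e \<and> \<phi> (s e) = ?\<psi> (s e)" using e by (simp add: transpose_def)
  qed ((use assms optimal_transpose r_in s_in in blast)+)
  then show ?thesis using ne assms(2) by (simp add: s_r transpose_def)
qed

lemma two_le_cost:
  assumes "p \<in> P" "q \<in> P" "p \<noteq> q"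
  shows "c (\<phi> p) (\<phi> (s p)) + c (\<phi> q) (\<phi> (s q)) \<le> cost \<phi>"
proof -
  have "(\<Sum>e\<in>{p,q}. c (\<phi> e) (\<phi> (s e))) \<le> cost \<phi>"
    unfolding cost_def using assms by (intro sum_mono2 finite_P) (auto simp: c_nonneg)
  then show ?thesis using assms by simp
qed

section \<open>Averaging over all exchanges at a broken step\<close>

text \<open>As \<phi>, \<open>s\<close> and \<open>r\<close> are bijections, each of the first four
  terms runs once over \<open>W\<close>, and each of the two subtracted step terms sums to
  \<open>cost \<phi>\<close>.\<close>

lemma sum_of_swaps:
  assumes "bij_betw \<phi> P W"
  shows "(\<Sum>q\<in>P. c z (\<phi> q) + c (\<phi> q) y + c (\<phi> (r q)) x + c x (\<phi> (s q))
      - (d + c (\<phi> (r q)) (\<phi> q) + c (\<phi> q) (\<phi> (s q))))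
    = (\<Sum>b\<in>W. c z b) + (\<Sum>b\<in>W. c b y) + (\<Sum>b\<in>W. c b x) + (\<Sum>b\<in>W. c x b)
      - int (card W) * d - 2 * cost \<phi>"
proof -
  have W: "(\<Sum>q\<in>P. f (\<phi> q)) = sum f W" for f :: "'a \<Rightarrow> int"
    by (rule sum.reindex_bij_betw[OF assms])
  have "(\<Sum>q\<in>P. c x (\<phi> (s q))) = (\<Sum>b\<in>W. c x b)"
    using sum.reindex_bij_betw[OF bij_s, of "\<lambda>q. c x (\<phi> q)"] W[of "c x"] by simp
  moreover have "(\<Sum>q\<in>P. c (\<phi> (r q)) x) = (\<Sum>b\<in>W. c b x)"
    using sum.reindex_bij_betw[OF bij_r, of "\<lambda>q. c (\<phi> q) x"] W[of "\<lambda>b. c b x"] by simp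
  moreover have "(\<Sum>q\<in>P. c (\<phi> (r q)) (\<phi> q)) = cost \<phi>"
    unfolding cost_def
    using sum.reindex_bij_betw[OF bij_r, of "\<lambda>q. c (\<phi> q) (\<phi> (s q))"] by (simp add: s_r)
  moreover have "card P = card W" using assms by (rule bij_betw_same_card)
  ultimately show ?thesis
    by (simp add: sum.distrib sum_subtractf W[of "c z"] W[of "\<lambda>b. c b y"] cost_def[symmetric])
qed

text \<open>Only the two neighbours of \<open>p\<close> can make \<open>D q\<close> negative. Their
  loss is affordable unless \<open>cost \<phi> = 1\<close> and \<open>c ?x ?z = c ?y ?x = 1\<close>.
  Then \<open>c ?w ?y = 1\<close> compensates, and \<open>c ?w ?y = 0\<close> is the second
  alternative.\<close>

lemma missing_lower_bound_or_tight:
  assumes opt: "optimal \<phi>" and p: "p \<in> P" and broken: "c (\<phi> p) (\<phi> (s p)) = 1"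
  shows "int (card W) + cost \<phi> - 1 \<le> (\<Sum>b\<in>W. c (\<phi> (r p)) b) + (\<Sum>b\<in>W. c b (\<phi> (s p)))
      + (\<Sum>b\<in>W. c b (\<phi> p)) + (\<Sum>b\<in>W. c (\<phi> p) b)
    \<or> c (\<phi> p) (\<phi> (r p)) = 1 \<and> c (\<phi> (s (s p))) (\<phi> (s p)) = 0"
proof -
  let ?x = "\<phi> p" and ?y = "\<phi> (s p)" and ?z = "\<phi> (r p)" and ?w = "\<phi> (s (s p))"
  let ?d = "c ?z ?x + 1"
  \<comment> \<open>For \<open>q \<notin> {p, s p, r p}\<close> this is the change of the cost when the vertices at \<open>p\<close> and \<open>q\<close> are
    exchanged; the three exceptional terms are bounded below separately.\<close>
  define D where "D q = c ?z (\<phi> q) + c (\<phi> q) ?y + c (\<phi> (r q)) ?x + c ?x (\<phi> (s q))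
    - (?d + c (\<phi> (r q)) (\<phi> q) + c (\<phi> q) (\<phi> (s q)))" for q
  note bnd = c_nonneg c_le
  have bij: "bij_betw \<phi> P W" using opt unfolding optimal_def by blast
  have sumD: "sum D P = (\<Sum>b\<in>W. c ?z b) + (\<Sum>b\<in>W. c b ?y) + (\<Sum>b\<in>W. c b ?x) + (\<Sum>b\<in>W. c ?x b)
      - int (card W) * ?d - 2 * cost \<phi>"
    unfolding D_def by (rule sum_of_swaps[OF bij])
  have far: "0 \<le> D q" if "q \<in> P - {p, s p, r p}" for q
    using swap_distant[OF opt p, of q] that broken unfolding D_def by auto
  have Dp: "D p = 0" using p unfolding D_def by (simp add: broken)
  have "s p \<in> P" "r p \<in> P" "s p \<noteq> p" "r p \<noteq> p" using p s_in r_in s_neq r_neq by auto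
  have "card {p, s p} \<le> card P"
    using p \<open>s p \<in> P\<close> finite_P by (intro card_mono) auto
  then have "2 \<le> card W" using \<open>s p \<noteq> p\<close> bij_betw_same_card[OF bij] by simp
  \<comment> \<open>The term \<open>int (card W) * c ?z ?x\<close> in \<open>sumD\<close> pays for a
    loss of \<open>2 * c ?z ?x\<close>.\<close>
  then have w: "2 * c ?z ?x \<le> int (card W) * c ?z ?x"
    using bnd by (intro mult_right_mono) auto
  have t2: "c ?x ?y + c (\<phi> e) (\<phi> (s e)) \<le> cost \<phi>" if "e \<in> P" "e \<noteq> p" for e
    using two_le_cost[of p e \<phi>] p that by auto
  have t1: "1 \<le> cost \<phi>"
    using t2[OF \<open>s p \<in> P\<close> \<open>s p \<noteq> p\<close>] c_nonneg[of ?y ?w] broken by linarith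
  show ?thesis
  proof (cases "s (s p) = p")
    \<comment> \<open>On a 2-cycle \<open>r p = s p\<close>, so \<open>?y = ?z\<close> and
      \<open>D (s p)\<close> is the only negative term.\<close>
    case True
    then have rp: "r p = s p" using p r_s s_in by metis
    have "sum D P = D p + D (s p) + sum D (P - {p, s p})"
      using p \<open>s p \<in> P\<close> \<open>s p \<noteq> p\<close> finite_P sum.subset_diff[of "{p, s p}" P D] by simp
    moreover have "0 \<le> sum D (P - {p, s p})"
      using far rp by (intro sum_nonneg) auto
    moreover have "D (s p) = - 2 - 2 * c ?z ?x"
      using p True rp broken unfolding D_def by (simp add: c_self r_s)
    ultimately show ?thesis using sumD Dp w t1 by (simp add: algebra_simps)
  next
    case False
    then have ne: "r p \<noteq> s p" using p s_r by metis
    have "s (s (r p)) \<noteq> r p" using p ne s_r by metis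
    note adj = swap_adjacent[OF opt p False] swap_adjacent[OF opt \<open>r p \<in> P\<close> this]
    have split: "sum D P = D p + D (s p) + D (r p) + sum D (P - {p, s p, r p})"
      using p \<open>s p \<in> P\<close> \<open>r p \<in> P\<close> \<open>s p \<noteq> p\<close> \<open>r p \<noteq> p\<close> ne finite_P
        sum.subset_diff[of "{p, s p, r p}" P D] by simp
    have rest: "0 \<le> sum D (P - {p, s p, r p})"
      using far by (intro sum_nonneg) auto
    have Ds: "D (s p) = c ?z ?y + c ?x ?w - c ?z ?x - 2 - c ?y ?w"
      using p broken unfolding D_def by (simp add: c_self r_s)
    have Dr: "D (r p) = c ?z ?y + c (\<phi> (r (r p))) ?x - 2 * c ?z ?x - 1 - c (\<phi> (r (r p))) ?z"
      using p unfolding D_def by (simp add: c_self s_r)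
    have Ds': "- 1 - c ?y ?x \<le> D (s p)" using adj(1) Ds broken by linarith
    have Dr': "- c ?x ?z - c ?z ?x \<le> D (r p)" using adj(2) Dr broken p by (simp add: s_r)
    show ?thesis
    \<comment> \<open>By \<open>Ds'\<close> and \<open>Dr'\<close> it suffices that
      \<open>c ?x ?z + c ?y ?x \<le> cost \<phi>\<close>; since \<open>1 \<le> cost \<phi>\<close>,
      this fails only in the case split off here.\<close>
    proof (cases "cost \<phi> = 1 \<and> c ?x ?z = 1 \<and> c ?y ?x = 1")
      case tight: True
      have zero: "c (\<phi> e) (\<phi> (s e)) = 0" if "e \<in> P" "e \<noteq> p" for e
        using t2[OF that] tight broken c_nonneg[of "\<phi> e" "\<phi> (s e)"] by linarith
      have zx: "c ?z ?x = 0" using zero[OF \<open>r p \<in> P\<close> \<open>r p \<noteq> p\<close>] p by (simp add: s_r)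
      have yw: "c ?y ?w = 0" using zero[OF \<open>s p \<in> P\<close> \<open>s p \<noteq> p\<close>] .
      have ssp: "s (s p) \<in> P" using \<open>s p \<in> P\<close> s_in by blast
      show ?thesis
      proof (cases "c ?w ?y = 0")
        case True then show ?thesis using tight by simp
      next
        case wy: False
        then have wy1: "c ?w ?y = 1" using c_nonneg[of ?w ?y] c_le[of ?w ?y] by linarith
        \<comment> \<open>The general estimate gives only \<open>- 3\<close>;
          \<open>c ?w ?y = 1\<close> has to recover one unit.\<close>
        have "- 2 \<le> sum D P"
        proof (cases "s (s p) = r p")
          \<comment> \<open>On a 3-cycle \<open>?w = ?z\<close>, and the gain appears in
            \<open>D (r p)\<close>.\<close>
          case True
          then have "r (r p) = s p" using r_s[OF \<open>s p \<in> P\<close>] by simp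
          then have "1 \<le> D (r p)" using Dr zx yw wy1 tight True by simp
          then show ?thesis using Ds' tight split rest Dp by linarith
        next
          \<comment> \<open>On a longer cycle \<open>s (s p)\<close> belongs to the nonnegative
            remainder, and its term there is at least 1.\<close>
          case far3: False
          have m: "s (s p) \<in> P - {p, s p, r p}"
            using far3 False ssp s_neq[OF \<open>s p \<in> P\<close>] by auto
          have "D (s (s p)) \<le> sum D (P - {p, s p, r p})"
            using m far finite_P by (intro member_le_sum) auto
          moreover have "1 \<le> D (s (s p))"
            using wy1 tight zx yw zero[OF ssp False] c_nonneg[of ?z ?w] c_nonneg[of ?x "\<phi> (s (s (s p)))"]
              \<open>s p \<in> P\<close> unfolding D_def by (simp add: r_s)
          ultimately show ?thesis using Ds' Dr' tight split Dp zx by linarith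
        qed
        then show ?thesis using sumD zx tight by simp
      qed
    next
      case False
      have "c ?x ?z + c ?y ?x \<le> cost \<phi>"
        using False t1 bnd[of ?x ?z] bnd[of ?y ?x] by linarith
      then have "- 1 - cost \<phi> - c ?z ?x \<le> sum D P" using split rest Ds' Dr' Dp by linarith
      then show ?thesis using sumD w c_nonneg[of ?z ?x] by (simp add: algebra_simps)
    qed
  qed
qed

end

text \<open>Reversing all arcs transposes \<open>c\<close> and traverses the cycles backwards; the
  assumptions are invariant under this.\<close>

lemma (in arrangement) reverse: "arrangement P r s (\<lambda>a b. c b a)"
  by unfold_locales (use finite_P s_in r_in r_s s_r r_neq c_self c_nonneg c_le in auto)

lemma (in arrangement) cost_reverse: "arrangement.cost P r (\<lambda>a b. c b a) \<phi> = cost \<phi>"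
  unfolding arrangement.cost_def[OF reverse] cost_def
  using sum.reindex_bij_betw[OF bij_r, of "\<lambda>q. c (\<phi> q) (\<phi> (s q))"] by (simp add: s_r)

text \<open>In the tight alternative the preceding bound is applied backwards, to the step from
  \<open>s p\<close> to \<open>p\<close>. Its own tight alternative would need
  \<open>c (\<phi> (s (s p))) (\<phi> (s p)) = 1\<close>, contrary to the forward one. The vertices
  \<open>a\<close> and \<open>b\<close> unify both cases.\<close>

lemma (in arrangement) missing_lower_bound:
  assumes opt: "optimal \<phi>" and p: "p \<in> P" and broken: "c (\<phi> p) (\<phi> (s p)) = 1"
  obtains a b where "a \<in> W" "b \<in> W"
    "int (card W) + cost \<phi> - 1 \<le> (\<Sum>v\<in>W. c (\<phi> p) v) + (\<Sum>v\<in>W. c v (\<phi> (s p)))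
      + (\<Sum>v\<in>W. c a v) + (\<Sum>v\<in>W. c v b)"
proof -
  interpret rev: arrangement P r s W "\<lambda>a b. c b a" by (rule reverse)
  have optr: "rev.optimal \<phi>"
    using opt unfolding rev.optimal_def optimal_def cost_reverse .
  have in_W: "\<phi> q \<in> W" if "q \<in> P" for q
    using opt that unfolding optimal_def by (blast dest: bij_betwE)
  have sp: "s p \<in> P" "r p \<in> P" "s (s p) \<in> P" using p s_in r_in by auto
  from missing_lower_bound_or_tight[OF opt p broken] show thesis
  proof
    assume "c (\<phi> p) (\<phi> (r p)) = 1 \<and> c (\<phi> (s (s p))) (\<phi> (s p)) = 0"
    then show thesis
      using rev.missing_lower_bound_or_tight[OF optr sp(1)] broken p that[of "\<phi> (s p)" "\<phi> (s (s p))"]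
        in_W sp by (simp add: r_s cost_reverse)
  qed (use that[of "\<phi> (r p)" "\<phi> p"] in_W sp p in simp)
qed

section \<open>Distinct representatives and counting\<close>

text \<open>Fewer than \<open>card B\<close> representatives are taken at any moment, so no
  \<open>S p\<close> is ever exhausted.\<close>

lemma greedy_distinct_representatives:
  assumes "finite B" "\<And>p. p \<in> B \<Longrightarrow> finite (S p) \<and> card B \<le> card (S p)"
  obtains g where "inj_on g B" "\<And>p. p \<in> B \<Longrightarrow> g p \<in> S p"
  using assms
proof (induction B arbitrary: thesis rule: finite_induct)
  case empty
  then show ?case by simp
next
  case (insert x B)
  obtain g where g: "inj_on g B" "\<And>p. p \<in> B \<Longrightarrow> g p \<in> S p"
    using insert.IH insert.prems(2) insert.hyps by (metis Suc_leD card_insert_disjoint insertCI)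
  have "card (g ` B) < card (S x)"
    using insert.prems(2)[of x] insert.hyps g(1) by (simp add: card_image)
  then obtain u where u: "u \<in> S x" "u \<notin> g ` B"
    using insert.hyps(1) by (metis card_mono finite_imageI leD subsetI)
  have "(g(x := u)) p \<in> S p" if "p \<in> insert x B" for p
    using that u g(2) by auto
  moreover have "inj_on (g(x := u)) (insert x B)"
    using g(1) u(2) insert.hyps(2) by (auto simp: inj_on_def)
  ultimately show ?case by (rule insert.prems(1)[rotated])
qed

lemma distinct_concat_map:
  assumes "distinct xs" "\<And>x. x \<in> set xs \<Longrightarrow> distinct (h x)"
    "\<And>x y. x \<in> set xs \<Longrightarrow> y \<in> set xs \<Longrightarrow> x \<noteq> y \<Longrightarrow> set (h x) \<inter> set (h y) = {}"
  shows "distinct (concat (map h xs))"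
  using assms
proof (induction xs)
  case (Cons a xs)
  have "set (h a) \<inter> set (h x) = {}" if "x \<in> set xs" for x
    using Cons.prems(1) that by (intro Cons.prems(3)) auto
  then have "set (h a) \<inter> set (concat (map h xs)) = {}" by auto
  moreover have "distinct (concat (map h xs))" using Cons.prems by (intro Cons.IH) auto
  ultimately show ?case using Cons.prems(2)[of a] by simp
qed simp

text \<open>With \<open>N\<close> a neighbourhood of \<open>x\<close> this counts missing
  neighbours; the \<open>1\<close> accounts for \<open>x\<close> itself.\<close>

lemma sum_of_bool_complement:
  assumes "finite V" "x \<in> V" "N \<subseteq> V - {x}"
  shows "(\<Sum>b\<in>V. of_bool (b \<noteq> x \<and> b \<notin> N)) = int (card V) - 1 - int (card N)"
proof -
  have N: "finite N" "x \<notin> N" "insert x N \<subseteq> V"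
    using assms finite_subset[OF assms(3)] by auto
  have "(\<Sum>b\<in>V. of_bool (b \<noteq> x \<and> b \<notin> N)) = int (card (V \<inter> {b. b \<noteq> x \<and> b \<notin> N}))"
    by (rule sum_of_bool_eq) (simp_all add: assms(1))
  also have "V \<inter> {b. b \<noteq> x \<and> b \<notin> N} = V - insert x N" by auto
  also have "int (card \<dots>) = int (card V) - int (card (insert x N))"
    using card_mono[OF assms(1) N(3)] N by (subst card_Diff_subset) auto
  finally show ?thesis using N by simp
qed

section \<open>Closed walks with distinct tails\<close>

context wf_digraph
begin

lemma cas_append: "cas u p v \<Longrightarrow> cas v q w \<Longrightarrow> cas u (p @ q) w"
  by (induction p arbitrary: u) auto

lemma cas_concat:
  "(\<And>j. j < m \<Longrightarrow> cas (f j) (seg j) (f (Suc j))) \<Longrightarrow> cas (f 0) (concat (map seg [0..<m])) (f m)"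
proof (induction m)
  case (Suc m)
  then show ?case using cas_append[of "f 0" _ "f m" "seg m" "f (Suc m)"] by simp
qed simp

text \<open>The heads of a closed walk are its tails shifted cyclically, so both lists have the same
  multiset. Distinct tails thus yield the distinct heads that \<open>cycle\<close> demands.\<close>

lemma
  assumes "cas u p u" "set p \<subseteq> arcs G" "p \<noteq> []" "distinct (map (tail G) p)"
  shows cycle_if_distinct_tails: "cycle p"
    and cycle_verts_eq_tails: "cycle_verts G p = tail G ` set p"
proof -
  have eq: "map (tail G) p @ [head G (last p)] = tail G (hd p) # map (head G) p"
    using awalk_verts_conv[of u p] awalk_verts_conv'[OF assms(1)] assms(3) by simp
  have hd: "tail G (hd p) = u"
    using assms(1,3) by (simp add: cas_simp)
  have last: "head G (last p) = u"
    using awlast_if_cas[OF assms(1)] assms(3) by (simp add: awalk_verts_conv)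
  have "mset (map (tail G) p @ [u]) = mset (u # map (head G) p)"
    using eq hd last by simp
  then have ms: "mset (map (tail G) p) = mset (map (head G) p)" by simp
  then have "distinct (map (head G) p)" using assms(4) mset_eq_imp_distinct_iff by blast
  moreover have "u \<in> verts G" using hd assms(2,3) by (metis hd_in_set subsetD tail_in_verts)
  ultimately show "cycle p"
    unfolding cycle_def awalk_def using assms(1-3) awalk_verts_conv'[OF assms(1)]
    by (intro exI[of _ u]) simp
  have "set (map (tail G) p) = set (map (head G) p)" using ms by (metis set_mset_mset)
  then show "cycle_verts G p = tail G ` set p" unfolding cycle_verts_def by simp
qed

end

section \<open>Counting non-arcs\<close>

context digraph
begin

text \<open>Diagonal pairs get 0, as \<open>c_self\<close> demands.\<close>

definition nonarc :: "'a \<Rightarrow> 'a \<Rightarrow> int" where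
  "nonarc a b = of_bool (a \<noteq> b \<and> (a, b) \<notin> arcs_ends G)"

text \<open>Without multiple arcs the out-degree counts out-neighbours, and without loops
  \<open>x\<close> is not among them.\<close>

lemma sum_nonarc_out:
  assumes "x \<in> verts G"
  shows "(\<Sum>b\<in>verts G. nonarc x b) = int (card (verts G)) - 1 - int (out_degree G x)"
proof -
  have "inj_on (head G) (out_arcs G x)"
    by (rule inj_onI) (auto intro: no_multi_arcs simp: arc_to_ends_def)
  then have "card (head G ` out_arcs G x) = out_degree G x"
    unfolding out_degree_def by (rule card_image)
  moreover have "head G ` out_arcs G x \<subseteq> verts G - {x}" using no_loops by force
  moreover have "nonarc x b = of_bool (b \<noteq> x \<and> b \<notin> head G ` out_arcs G x)" for b
    unfolding nonarc_def by (auto simp: arcs_ends_def arc_to_ends_def)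
  ultimately show ?thesis using sum_of_bool_complement[OF finite_verts assms] by simp
qed

lemma sum_nonarc_in:
  assumes "x \<in> verts G"
  shows "(\<Sum>b\<in>verts G. nonarc b x) = int (card (verts G)) - 1 - int (in_degree G x)"
proof -
  have "inj_on (tail G) (in_arcs G x)"
    by (rule inj_onI) (auto intro: no_multi_arcs simp: arc_to_ends_def)
  then have "card (tail G ` in_arcs G x) = in_degree G x"
    unfolding in_degree_def by (rule card_image)
  moreover have "tail G ` in_arcs G x \<subseteq> verts G - {x}" using no_loops by force
  moreover have "nonarc b x = of_bool (b \<noteq> x \<and> b \<notin> tail G ` in_arcs G x)" for b
    unfolding nonarc_def by (auto simp: arcs_ends_def arc_to_ends_def)
  ultimately show ?thesis using sum_of_bool_complement[OF finite_verts assms] by simp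
qed

text \<open>Of \<open>n - 1\<close> possible arcs in each direction at most
  \<open>n - 1 - (3 * n - 3) / 4 = (n - 1) / 4\<close> are missing; the factor 4 keeps this
  integral.\<close>

lemma four_nonarcs_le:
  assumes "W \<subseteq> verts G" "real (min_semidegree G W) \<ge> (3 * real (card (verts G)) - 3) / 4" "x \<in> W"
  shows "4 * (\<Sum>b\<in>verts G. nonarc x b) \<le> int (card (verts G)) - 1"
    and "4 * (\<Sum>b\<in>verts G. nonarc b x) \<le> int (card (verts G)) - 1"
proof -
  have x: "x \<in> verts G" and fin: "finite W" using assms by (auto intro: finite_subset)
  have "min_semidegree G W \<le> out_degree G x" "min_semidegree G W \<le> in_degree G x"
    unfolding min_semidegree_def min_out_degree_def min_in_degree_def
    using fin assms(3) by (auto intro: min.coboundedI1 min.coboundedI2)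
  then have "3 * real (card (verts G)) - 3 \<le> 4 * real (out_degree G x)"
    "3 * real (card (verts G)) - 3 \<le> 4 * real (in_degree G x)"
    using assms(2) by simp_all
  then have "3 * int (card (verts G)) - 3 \<le> 4 * int (out_degree G x)"
    "3 * int (card (verts G)) - 3 \<le> 4 * int (in_degree G x)"
    by linarith+
  then show "4 * (\<Sum>b\<in>verts G. nonarc x b) \<le> int (card (verts G)) - 1"
    "4 * (\<Sum>b\<in>verts G. nonarc b x) \<le> int (card (verts G)) - 1"
    using sum_nonarc_out[OF x] sum_nonarc_in[OF x] by linarith+
qed

text \<open>The four counts total at most \<open>n - 1\<close>, and \<open>W\<close> already takes
  \<open>card W + t - 1\<close> of this. So outside \<open>W\<close> at most
  \<open>card (verts G - W) - t\<close> non-arcs leave \<open>x\<close> or enter \<open>y\<close>,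
  and at least \<open>t\<close> vertices escape them.\<close>

lemma common_neighbours_ge:
  assumes "W \<subseteq> verts G" "x \<in> W" "y \<in> W" "a \<in> W" "b \<in> W"
    "real (min_semidegree G W) \<ge> (3 * real (card (verts G)) - 3) / 4"
    "int (card W) + t - 1 \<le> (\<Sum>v\<in>W. nonarc x v) + (\<Sum>v\<in>W. nonarc v y)
      + (\<Sum>v\<in>W. nonarc a v) + (\<Sum>v\<in>W. nonarc v b)"
  shows "t \<le> int (card {u \<in> verts G - W. (x, u) \<in> arcs_ends G \<and> (u, y) \<in> arcs_ends G})"
proof -
  let ?U = "verts G - W"
  let ?S = "{u \<in> ?U. (x, u) \<in> arcs_ends G \<and> (u, y) \<in> arcs_ends G}"
  have fin: "finite ?U" "finite W" using assms(1) by (auto intro: finite_subset)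
  have split: "(\<Sum>v\<in>verts G. f v) = (\<Sum>v\<in>?U. f v) + (\<Sum>v\<in>W. f v)" for f :: "'a \<Rightarrow> int"
    by (rule sum.subset_diff[OF assms(1) finite_verts])
  have nonneg: "0 \<le> (\<Sum>v\<in>?U. nonarc a v)" "0 \<le> (\<Sum>v\<in>?U. nonarc v b)"
    by (auto simp: nonarc_def intro: sum_nonneg)
  have card: "card (verts G) = card ?U + card W"
    using assms(1) fin finite_verts by (metis card_Diff_subset card_mono le_add_diff_inverse2)
  have "int (card ?U) \<le> (\<Sum>u\<in>?U. of_bool (u \<in> ?S) + nonarc x u + nonarc u y)"
  proof -
    \<comment> \<open>As \<open>x\<close> and \<open>y\<close> lie in \<open>W\<close>,
      \<open>u\<close> differs from both, so \<open>nonarc\<close> vanishes here only for actual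
      arcs.\<close>
    have "1 \<le> of_bool (u \<in> ?S) + nonarc x u + nonarc u y" if "u \<in> ?U" for u
      using that assms(2,3) by (auto simp: nonarc_def)
    then have "(\<Sum>u\<in>?U. 1) \<le> (\<Sum>u\<in>?U. of_bool (u \<in> ?S) + nonarc x u + nonarc u y)"
      by (rule sum_mono)
    then show ?thesis by simp
  qed
  also have "\<dots> = int (card ?S) + (\<Sum>u\<in>?U. nonarc x u) + (\<Sum>u\<in>?U. nonarc u y)"
  proof -
    have "(\<Sum>u\<in>?U. of_bool (u \<in> ?S)) = int (card (?U \<inter> {u. u \<in> ?S}))"
      by (rule sum_of_bool_eq) (rule fin(1))+
    moreover have "?U \<inter> {u. u \<in> ?S} = ?S" by blast
    ultimately show ?thesis by (simp only: sum.distrib)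
  qed
  finally have few: "int (card ?U) \<le> int (card ?S) + (\<Sum>u\<in>?U. nonarc x u) + (\<Sum>u\<in>?U. nonarc u y)" .
  have "(\<Sum>v\<in>verts G. nonarc x v) + (\<Sum>v\<in>verts G. nonarc v y)
      + (\<Sum>v\<in>verts G. nonarc a v) + (\<Sum>v\<in>verts G. nonarc v b) \<le> int (card (verts G)) - 1"
    using four_nonarcs_le(1)[OF assms(1,6,2)] four_nonarcs_le(2)[OF assms(1,6,3)]
      four_nonarcs_le(1)[OF assms(1,6,4)] four_nonarcs_le(2)[OF assms(1,6,5)] by linarith
  also have "int (card (verts G)) = int (card ?U) + int (card W)" using card by simp
  \<comment> \<open>Outside \<open>W\<close> the counts for \<open>a\<close> and \<open>b\<close>
    are nonnegative and are dropped.\<close>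
  finally have "(\<Sum>u\<in>?U. nonarc x u) + (\<Sum>u\<in>?U. nonarc u y)
      + ((\<Sum>v\<in>W. nonarc x v) + (\<Sum>v\<in>W. nonarc v y) + (\<Sum>v\<in>W. nonarc a v) + (\<Sum>v\<in>W. nonarc v b))
    \<le> int (card ?U) + int (card W) - 1"
    unfolding split using nonneg by linarith
  then show ?thesis using assms(7) few by linarith
qed

section \<open>Repairing the broken steps\<close>

text \<open>In an optimal arrangement \<open>cost \<phi>\<close> is the number of broken positions,
  and each of them has at least that many candidate vertices \<open>S p\<close>, so the greedy
  choice applies.\<close>

lemma repairable_arrangement:
  fixes P :: "'p set"
  assumes W: "W \<subseteq> verts G" and deg: "real (min_semidegree G W) \<ge> (3 * real (card (verts G)) - 3) / 4"
    and arr: "arrangement P s r nonarc" and card: "card P = card W"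
  obtains \<phi> g where "bij_betw \<phi> P W"
    "inj_on g {p \<in> P. (\<phi> p, \<phi> (s p)) \<notin> arcs_ends G}"
    "\<forall>p\<in>P. (\<phi> p, \<phi> (s p)) \<notin> arcs_ends G \<longrightarrow>
      g p \<in> verts G - W \<and> (\<phi> p, g p) \<in> arcs_ends G \<and> (g p, \<phi> (s p)) \<in> arcs_ends G"
proof -
  interpret arrangement P s r W nonarc by (rule arr)
  have finW: "finite W" using W by (auto intro: finite_subset)
  obtain \<phi> where opt: "optimal \<phi>" by (rule optimal_exists[OF card finW])
  then have bij: "bij_betw \<phi> P W" unfolding optimal_def by blast
  define B where "B = {p \<in> P. (\<phi> p, \<phi> (s p)) \<notin> arcs_ends G}"
  define S where "S p = {u \<in> verts G - W. (\<phi> p, u) \<in> arcs_ends G \<and> (u, \<phi> (s p)) \<in> arcs_ends G}" for p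
  \<comment> \<open>Consecutive positions carry distinct vertices, so \<open>nonarc\<close> detects
    exactly the broken steps.\<close>
  have nonarc: "nonarc (\<phi> p) (\<phi> (s p)) = of_bool ((\<phi> p, \<phi> (s p)) \<notin> arcs_ends G)" if "p \<in> P" for p
    using that bij s_in s_neq unfolding nonarc_def bij_betw_def inj_on_def by auto metis
  have "cost \<phi> = (\<Sum>p\<in>P. of_bool ((\<phi> p, \<phi> (s p)) \<notin> arcs_ends G))"
    unfolding cost_def using nonarc by (intro sum.cong) auto
  also have "\<dots> = int (card (P \<inter> B))"
    using finite_P unfolding B_def by (subst sum_of_bool_eq) (auto intro: arg_cong[where f = card])
  also have "P \<inter> B = B" unfolding B_def by auto
  finally have cost: "cost \<phi> = int (card B)" .
  have "card B \<le> card (S p)" if p: "p \<in> B" for p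
  proof -
    have pP: "p \<in> P" and "nonarc (\<phi> p) (\<phi> (s p)) = 1" using p nonarc unfolding B_def by auto
    from missing_lower_bound[OF opt this] obtain a b where "a \<in> W" "b \<in> W"
      "int (card W) + cost \<phi> - 1 \<le> (\<Sum>v\<in>W. nonarc (\<phi> p) v) + (\<Sum>v\<in>W. nonarc v (\<phi> (s p)))
      + (\<Sum>v\<in>W. nonarc a v) + (\<Sum>v\<in>W. nonarc v b)" .
    moreover have "\<phi> p \<in> W" "\<phi> (s p) \<in> W" using bij_betwE[OF bij] pP s_in by auto
    ultimately have "cost \<phi> \<le> int (card (S p))"
      unfolding S_def using common_neighbours_ge[OF W] deg by blast
    then show ?thesis using cost by simp
  qed
  moreover have "finite (S p)" for p unfolding S_def by simp
  moreover have "finite B" using finite_P unfolding B_def by simp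
  ultimately obtain g where g: "inj_on g B" "\<And>p. p \<in> B \<Longrightarrow> g p \<in> S p"
    using greedy_distinct_representatives[of B S] by metis
  show thesis
    by (rule that[OF bij]) (use g in \<open>auto simp: B_def S_def\<close>)
qed

lemma arcs_endsE:
  assumes "(a, b) \<in> arcs_ends G"
  obtains e where "e \<in> arcs G" "tail G e = a" "head G e = b"
  using assms unfolding arcs_ends_def arc_to_ends_def by auto

text \<open>Each position contributes one arc, or two arcs through \<open>g j\<close> if its step is
  broken. The tails are the \<open>f j\<close> in \<open>W\<close> and the \<open>g j\<close>
  outside it, all distinct, so the concatenated closed walk is a cycle.\<close>

lemma repaired_cycle:
  assumes m: "m > 0" and inj: "inj_on f {..<m}" and f: "f ` {..<m} \<subseteq> W"
    and B: "B = {j. j < m \<and> (f j, f (Suc j mod m)) \<notin> arcs_ends G}" and g_inj: "inj_on g B"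
    and g: "\<And>j. j \<in> B \<Longrightarrow>
      g j \<notin> W \<and> (f j, g j) \<in> arcs_ends G \<and> (g j, f (Suc j mod m)) \<in> arcs_ends G"
  obtains p where "cycle p" "cycle_verts G p = f ` {..<m} \<union> g ` B"
proof -
  let ?verts = "\<lambda>j. f j # (if j \<in> B then [g j] else [])"
  have "\<exists>p. cas (f j) p (f (Suc j mod m)) \<and> set p \<subseteq> arcs G \<and> map (tail G) p = ?verts j"
    if "j < m" for j
  proof (cases "j \<in> B")
    case True
    obtain d e where "d \<in> arcs G" "tail G d = f j" "head G d = g j"
      "e \<in> arcs G" "tail G e = g j" "head G e = f (Suc j mod m)"
      using g[OF True] by (metis arcs_endsE)
    then show ?thesis using True by (intro exI[of _ "[d, e]"]) simp
  next
    case False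
    then have "(f j, f (Suc j mod m)) \<in> arcs_ends G" using that B by blast
    then obtain e where "e \<in> arcs G" "tail G e = f j" "head G e = f (Suc j mod m)"
      by (rule arcs_endsE)
    then show ?thesis using False by (intro exI[of _ "[e]"]) simp
  qed
  then obtain seg where seg: "\<And>j. j < m \<Longrightarrow> cas (f j) (seg j) (f (Suc j mod m)) \<and>
      set (seg j) \<subseteq> arcs G \<and> map (tail G) (seg j) = ?verts j"
    by metis
  define p where "p = concat (map seg [0..<m])"
  \<comment> \<open>Reducing indices modulo \<open>m\<close> makes the last segment end at
    \<open>f 0\<close>.\<close>
  have "cas (f (0 mod m)) p (f (m mod m))"
    unfolding p_def by (rule cas_concat[where f = "\<lambda>j. f (j mod m)"]) (use seg in simp)
  then have cas: "cas (f 0) p (f 0)" by simp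
  have arcs: "set p \<subseteq> arcs G" unfolding p_def using seg by fastforce
  have tails: "map (tail G) p = concat (map ?verts [0..<m])"
    unfolding p_def map_concat map_map by (rule arg_cong[where f = concat]) (use seg in simp)
  have "distinct (concat (map ?verts [0..<m]))"
  proof (rule distinct_concat_map)
    fix i j assume "i \<in> set [0..<m]" "j \<in> set [0..<m]" "i \<noteq> j"
    then show "set (?verts i) \<inter> set (?verts j) = {}"
      using inj g_inj f g unfolding inj_on_def by (auto simp: image_subset_iff) (metis lessThan_iff)+
  next
    fix j assume "j \<in> set [0..<m]"
    then have "f j \<in> W" using f by auto
    then show "distinct (?verts j)" using g by auto
  qed simp
  then have dist: "distinct (map (tail G) p)" using tails by simp
  have set: "tail G ` set p = f ` {..<m} \<union> g ` B"
  proof -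
    have "tail G ` set p = (\<Union>j<m. set (?verts j))"
      using arg_cong[OF tails, of set] by auto
    also have "\<dots> = f ` {..<m} \<union> g ` B" using B by (auto split: if_splits)
    finally show ?thesis .
  qed
  then have "p \<noteq> []" using m by auto
  with that cycle_if_distinct_tails[OF cas arcs _ dist] cycle_verts_eq_tails[OF cas arcs _ dist] set
  show thesis by simp
qed

end

section \<open>Assembling the cycle factor\<close>

lemma Suc_mod_neq: "(j::nat) < m \<Longrightarrow> 2 \<le> m \<Longrightarrow> Suc j mod m \<noteq> j"
  by (cases "Suc j = m") auto

text \<open>Position \<open>(i, j)\<close> is the \<open>j\<close>-th place on the
  \<open>i\<close>-th cycle. Adding \<open>ns i\<close> before subtracting 1 avoids truncation at
  \<open>j = 0\<close>; \<open>2 \<le> ns i\<close> rules out fixed points.\<close>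

lemma arrangement_cycles:
  fixes ns :: "nat \<Rightarrow> nat" and c :: "'a \<Rightarrow> 'a \<Rightarrow> int"
  assumes "\<And>i. i \<in> I \<Longrightarrow> 2 \<le> ns i" "finite I"
    and "\<And>a. c a a = 0" "\<And>a b. 0 \<le> c a b" "\<And>a b. c a b \<le> 1"
  shows "arrangement (SIGMA i:I. {..<ns i}) (\<lambda>(i, j). (i, Suc j mod ns i))
    (\<lambda>(i, j). (i, (j + ns i - 1) mod ns i)) c"
proof
  fix q assume "q \<in> (SIGMA i:I. {..<ns i})"
  then obtain i j where q: "q = (i, j)" "i \<in> I" "j < ns i" by auto
  then have 2: "2 \<le> ns i" using assms(1) by blast
  show "(\<lambda>(i, j). (i, Suc j mod ns i)) q \<noteq> q" using q 2 Suc_mod_neq by simp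
  show "(\<lambda>(i, j). (i, (j + ns i - 1) mod ns i)) ((\<lambda>(i, j). (i, Suc j mod ns i)) q) = q"
    using q 2 by (cases "Suc j = ns i") auto
  show "(\<lambda>(i, j). (i, Suc j mod ns i)) ((\<lambda>(i, j). (i, (j + ns i - 1) mod ns i)) q) = q"
    using q 2 by (cases j) auto
qed (use assms in auto)

theorem theorem2:
  fixes D :: "('a, 'b) pre_digraph" and W :: "'a set" and n :: nat
  assumes "digraph D"
    and "card (verts D) = n"
    and "W \<subseteq> verts D"
    and "real (min_semidegree D W) \<ge> (3 * real n - 3) / 4"
  shows "arbitrary_cycle_factor D W"
  unfolding arbitrary_cycle_factor_def
proof (intro allI impI, elim conjE)
  interpret digraph D by (rule assms(1))
  fix k :: nat and ns :: "nat \<Rightarrow> nat"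
  assume ns: "\<forall>i\<in>{1..k}. 2 \<le> ns i" and sum: "card W = (\<Sum>i=1..k. ns i)"
  define P where "P = (SIGMA i:{1..k}. {..<ns i})"
  define s where "s = (\<lambda>(i, j). (i, Suc j mod ns i) :: nat \<times> nat)"
  have arr: "arrangement P s (\<lambda>(i, j). (i, (j + ns i - 1) mod ns i)) nonarc"
    unfolding P_def s_def using ns by (intro arrangement_cycles) (auto simp: nonarc_def)
  have card: "card P = card W" unfolding P_def using sum by simp
  have deg: "real (min_semidegree D W) \<ge> (3 * real (card (verts D)) - 3) / 4" using assms(2,4) by simp
  obtain \<phi> g where bij: "bij_betw \<phi> P W"
    and g_inj: "inj_on g {p \<in> P. (\<phi> p, \<phi> (s p)) \<notin> arcs_ends D}"
    and g: "\<forall>p\<in>P. (\<phi> p, \<phi> (s p)) \<notin> arcs_ends D \<longrightarrow>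
      g p \<in> verts D - W \<and> (\<phi> p, g p) \<in> arcs_ends D \<and> (g p, \<phi> (s p)) \<in> arcs_ends D"
    by (rule repairable_arrangement[OF assms(3) deg arr card])
  have inj: "\<phi> p = \<phi> q \<longleftrightarrow> p = q" if "p \<in> P" "q \<in> P" for p q
    using bij that unfolding bij_betw_def by (meson inj_on_eq_iff)
  have P: "(i, j) \<in> P" if "i \<in> {1..k}" "j < ns i" for i j using that unfolding P_def by simp
  have in_W: "\<phi> p \<in> W" if "p \<in> P" for p using bij that by (blast dest: bij_betwE)
  define B where "B i = {j. j < ns i \<and> (\<phi> (i, j), \<phi> (s (i, j))) \<notin> arcs_ends D}" for i
  have "\<exists>p. cycle p \<and> cycle_verts D p = (\<lambda>j. \<phi> (i, j)) ` {..<ns i} \<union> (\<lambda>j. g (i, j)) ` B i"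
    if i: "i \<in> {1..k}" for i
  proof -
    let ?f = "\<lambda>j. \<phi> (i, j)" and ?g = "\<lambda>j. g (i, j)"
    have "0 < ns i" using ns i by fastforce
    moreover have "inj_on ?f {..<ns i}" using inj P[OF i] by (auto simp: inj_on_def)
    moreover have "?f ` {..<ns i} \<subseteq> W" using in_W P[OF i] by auto
    moreover have B: "B i = {j. j < ns i \<and> (?f j, ?f (Suc j mod ns i)) \<notin> arcs_ends D}"
      unfolding B_def s_def by simp
    moreover have "inj_on ?g (B i)" using g_inj P[OF i] unfolding B_def inj_on_def by blast
    moreover have "?g j \<notin> W \<and> (?f j, ?g j) \<in> arcs_ends D \<and> (?g j, ?f (Suc j mod ns i)) \<in> arcs_ends D"
      if "j \<in> B i" for j
      using that g[rule_format, OF P[OF i], of j] unfolding B by (simp add: s_def)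
    ultimately obtain p where "cycle p" "cycle_verts D p = ?f ` {..<ns i} \<union> ?g ` B i"
      by (rule repaired_cycle)
    then show ?thesis by blast
  qed
  then obtain C where C: "\<And>i. i \<in> {1..k} \<Longrightarrow> cycle (C i) \<and>
      cycle_verts D (C i) = (\<lambda>j. \<phi> (i, j)) ` {..<ns i} \<union> (\<lambda>j. g (i, j)) ` B i"
    by metis
  have gB: "g (i, j) \<notin> W" if "i \<in> {1..k}" "j \<in> B i" for i j
    using that g P unfolding B_def by blast
  show "\<exists>C. (\<forall>i\<in>{1..k}. cycle (C i)) \<and> disjoint_family_on (\<lambda>i. cycle_verts D (C i)) {1..k} \<and>
      (\<forall>i\<in>{1..k}. card (cycle_verts D (C i) \<inter> W) = ns i)"
  proof (intro exI conjI ballI)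
    show "disjoint_family_on (\<lambda>i. cycle_verts D (C i)) {1..k}"
      unfolding disjoint_family_on_def
    proof (intro ballI impI)
      fix i i' assume ii: "i \<in> {1..k}" "i' \<in> {1..k}" "i \<noteq> i'"
      \<comment> \<open>Arranged vertices differ because \<phi> is injective on \<open>P\<close>,
        inserted ones because \<open>g\<close> is injective across all cycles, and mixed pairs
        because only the former lie in \<open>W\<close>.\<close>
      have "\<phi> (i, j) \<noteq> \<phi> (i', j')" if "j < ns i" "j' < ns i'" for j j'
        using inj[OF P P] ii that by simp
      moreover have "g (i, j) \<noteq> g (i', j')" if "j \<in> B i" "j' \<in> B i'" for j j'
        using g_inj ii that P unfolding B_def inj_on_def by blast
      moreover have "\<phi> (i, j) \<in> W" if "j < ns i" for j using in_W P ii that by blast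
      moreover have "\<phi> (i', j) \<in> W" if "j < ns i'" for j using in_W P ii that by blast
      ultimately show "cycle_verts D (C i) \<inter> cycle_verts D (C i') = {}"
        using C ii gB by (auto, metis+)
    qed
  next
    fix i assume i: "i \<in> {1..k}"
    \<comment> \<open>Inserted vertices lie outside \<open>W\<close>, so only the
      \<open>ns i\<close> arranged ones are counted.\<close>
    have "cycle_verts D (C i) \<inter> W = (\<lambda>j. \<phi> (i, j)) ` {..<ns i}"
      using C[OF i] gB[OF i] in_W P[OF i] by auto
    moreover have "inj_on (\<lambda>j. \<phi> (i, j)) {..<ns i}" using inj P[OF i] by (auto simp: inj_on_def)
    ultimately show "card (cycle_verts D (C i) \<inter> W) = ns i" by (simp add: card_image)
  qed (use C in blast)
qed

end
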